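(* Let $M\in\mathbb{R}^{m\times d}$ with $m<d$ have linearly independent rows and let $\Omega\in\mathbb{R}^{p\times d}$. Let $N^T$ be any $d\times(d-m)$ matrix whose columns form a basis of $\operatorname{Null}(M)$, and let $\Lambda\subseteq\{1,\dots,p\}$, $|\Lambda|=\ell$, be a fixed cosupport such that the $\ell\times(d-m)$ matrix $\Omega_\Lambda N^T$ is of full rank $d-m$. Let a signal $x_0\in\mathbb{R}^d$ with $\Omega_\Lambda x_0=0$ and an observation $y=Mx_0$ be given. Suppose that $$\left\|(N\Omega_\Lambda^T)^\dagger N\Omega_{\Lambda^c}^T\right\|_{\infty\to\infty}<1 .$$ Then, when applied to the problem of minimizing $\|\Omega x\|_0$ subject to $Mx=y$, the Greedy Analysis Pursuit (GAP) algorithm with selection factor $$t\ \ge\ \left\|(N\Omega_\Lambda^T)^\dagger N\Omega_{\Lambda^c}^T\right\|_{\infty\to\infty}$$ will recover $x_0$ after at most $|\Lambda^c|$ iterations.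
   Context: $\|v\|_0$ is the number of nonzero entries of $v$. The cosupport of a vector $x\in\mathbb{R}^d$ with respect to $\Omega\in\mathbb{R}^{p\times d}$ is the index set $\{i:(\Omega x)_i=0\}$. For an index set $\Lambda\subseteq\{1,\dots,p\}$, $\Omega_\Lambda$ is the submatrix of $\Omega$ consisting of the rows indexed by $\Lambda$, and $\Lambda^c$ is the complement of $\Lambda$ in $\{1,\dots,p\}$. $A^\dagger$ is the Moore–Penrose pseudo-inverse of $A$; $\|A\|_{\infty\to\infty}$ is the operator norm induced by the $\ell_\infty$ norms. The GAP algorithm, given $M$, $\Omega$, $y$, a target number of zeros $\ell$ and a selection factor $t\in(0,1]$, produces index sets $\hat\Lambda_k$ and estimates $\hat x_k$ as follows. Initialization ($k=0$): $\hat\Lambda_0=\{1,\dots,p\}$ and $$\hat x_0=\arg\min_x\|\Omega_{\hat\Lambda_0}x\|_2^2\ \text{ subject to }\ y=Mx .$$ Iteration $k\ge1$: compute the coefficients $\alpha_i=(\Omega\hat x_{k-1})_i$ for the remaining indices $i\in\hat\Lambda_{k-1}$; set $\Gamma_k=\{i\in\hat\Lambda_{k-1}:|\alpha_i|\ge t\max_{j\in\hat\Lambda_{k-1}}|\alpha_j|\}$; set $\hat\Lambda_k=\hat\Lambda_{k-1}\setminus\Gamma_k$; and set $$\hat x_k=\arg\min_x\|\Omega_{\hat\Lambda_k}x\|_2^2\ \text{ subject to }\ y=Mx .$$ Stop when $k\ge p-d+m$ (or $k\ge p-\ell$) and output $\hat x_k$. (The initial estimate $\hat x_0$ is not to be confused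 with the target signal $x_0$.)
   Formalization: For t equal to the norm, recovery can fail: a cosupport row may tie, be removed and leave the argmin non-unique. There it is only claimed that x_0 is one of the minimizers at some iteration k ≤ |Λ^c|; for t above the norm some estimate x̂_k with k ≤ |Λ^c| equals x_0. *)

theory Defs
  imports
    Complex_Main
    "Jordan_Normal_Form.Matrix_Kernel"
    "Jordan_Normal_Form.DL_Rank"
    "Jordan_Normal_Form.DL_Submatrix"
begin

(* Indices start at 0: the rows of a p x d matrix are numbered by {0..<p}. *)

abbreviation row_submatrix :: "real mat \<Rightarrow> nat set \<Rightarrow> real mat" where
  "row_submatrix A I \<equiv> submatrix A I UNIV"

definition is_pseudo_inverse :: "real mat \<Rightarrow> real mat \<Rightarrow> bool" where
  "is_pseudo_inverse A X \<longleftrightarrow>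
     X \<in> carrier_mat (dim_col A) (dim_row A) \<and>
     A * X * A = A \<and> X * A * X = X \<and>
     (A * X)\<^sup>T = A * X \<and> (X * A)\<^sup>T = X * A"

definition pseudo_inverse :: "real mat \<Rightarrow> real mat" where
  "pseudo_inverse A = (THE X. is_pseudo_inverse A X)"

lemma is_pseudo_inverse_unique:
  assumes "is_pseudo_inverse A X" and "is_pseudo_inverse A Y"
  shows "X = Y"
proof -
  define r c where "r = dim_row A" and "c = dim_col A"
  have A: "A \<in> carrier_mat r c" and X: "X \<in> carrier_mat c r" and Y: "Y \<in> carrier_mat c r"
    using assms by (auto simp: r_def c_def is_pseudo_inverse_def)
  have AX: "A * X \<in> carrier_mat r r" and AY: "A * Y \<in> carrier_mat r r"
    and XA: "X * A \<in> carrier_mat c c" and YA: "Y * A \<in> carrier_mat c c"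
    using A X Y by auto
  have x: "A * X * A = A" "X * A * X = X" "(A * X)\<^sup>T = A * X" "(X * A)\<^sup>T = X * A"
    and y: "A * Y * A = A" "Y * A * Y = Y" "(A * Y)\<^sup>T = A * Y" "(Y * A)\<^sup>T = Y * A"
    using assms by (auto simp: is_pseudo_inverse_def)
  have "A * X = A * Y * A * X" by (simp only: y)
  also have "\<dots> = (A * Y) * (A * X)" by (rule assoc_mult_mat[OF AY A X])
  also have "\<dots> = (A * Y)\<^sup>T * (A * X)\<^sup>T" by (simp only: x y)
  also have "\<dots> = ((A * X) * (A * Y))\<^sup>T" by (rule transpose_mult[OF AX AY, symmetric])
  also have "(A * X) * (A * Y) = A * X * A * Y" by (rule assoc_mult_mat[OF AX A Y, symmetric])
  also have "\<dots>\<^sup>T = A * Y" by (simp only: x y)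
  finally have 1: "A * X = A * Y" .
  have "X * A = X * (A * Y * A)" by (simp only: y)
  also have "\<dots> = (X * A) * (Y * A)"
    using assoc_mult_mat[OF X A YA] assoc_mult_mat[OF A Y A] by simp
  also have "\<dots> = (X * A)\<^sup>T * (Y * A)\<^sup>T" by (simp only: x y)
  also have "\<dots> = ((Y * A) * (X * A))\<^sup>T" by (rule transpose_mult[OF YA XA, symmetric])
  also have "(Y * A) * (X * A) = Y * (A * X * A)"
    using assoc_mult_mat[OF Y A XA] assoc_mult_mat[OF A X A] by simp
  also have "\<dots>\<^sup>T = Y * A" by (simp only: x y)
  finally have 2: "X * A = Y * A" .
  have "X = X * A * X" by (simp only: x)
  also have "\<dots> = Y * A * X" by (simp only: 2)
  also have "\<dots> = Y * (A * X)" by (rule assoc_mult_mat[OF Y A X])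
  also have "\<dots> = Y * (A * Y)" by (simp only: 1)
  also have "\<dots> = Y * A * Y" by (rule assoc_mult_mat[OF Y A Y, symmetric])
  also have "\<dots> = Y" by (simp only: y)
  finally show ?thesis .
qed

(* The inserted 0 only matters in dimension 0, where it keeps Max well-defined. *)
definition linf_norm :: "real vec \<Rightarrow> real" where
  "linf_norm v = Max (insert 0 ((\<lambda>i. \<bar>v $ i\<bar>) ` {0..<dim_vec v}))"

definition linf_opnorm :: "real mat \<Rightarrow> real" where
  "linf_opnorm A =
     Sup {linf_norm (A *\<^sub>v v) | v. v \<in> carrier_vec (dim_col A) \<and> linf_norm v \<le> 1}"

(* The set of all minimizers: once L no longer determines x on Null(M),
   the constrained least-squares problem has more than one solution. *)
definition gap_solutions :: "real mat \<Rightarrow> real mat \<Rightarrow> real vec \<Rightarrow> nat set \<Rightarrow> real vec set" where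
  "gap_solutions M \<Omega> y L =
     {x. is_arg_min
           (\<lambda>z. (row_submatrix \<Omega> L *\<^sub>v z) \<bullet> (row_submatrix \<Omega> L *\<^sub>v z))
           (\<lambda>z. z \<in> carrier_vec (dim_col M) \<and> y = M *\<^sub>v z) x}"

(* Max {} is unspecified, but for L = {} the selected set is empty anyway. *)
definition gap_select :: "real \<Rightarrow> real vec \<Rightarrow> nat set \<Rightarrow> nat set" where
  "gap_select t \<alpha> L = {i \<in> L. \<bar>\<alpha> $ i\<bar> \<ge> t * Max ((\<lambda>j. \<bar>\<alpha> $ j\<bar>) ` L)}"

(* L k and x k are the index set and the estimate after k iterations; the run stops at k = K.
   A run may use any minimizer as its estimate, so a statement about all runs does not
   depend on how ties between minimizers are broken. Note that a run need not stay at a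
   point it has recovered: if all remaining coefficients vanish, the selection rule
   discards every remaining index in the next iteration. *)
definition gap_run ::
  "real mat \<Rightarrow> real mat \<Rightarrow> real vec \<Rightarrow> real \<Rightarrow> nat \<Rightarrow>
   (nat \<Rightarrow> nat set) \<Rightarrow> (nat \<Rightarrow> real vec) \<Rightarrow> bool" where
  "gap_run M \<Omega> y t K L x \<longleftrightarrow>
     L 0 = {0..<dim_row \<Omega>} \<and> x 0 \<in> gap_solutions M \<Omega> y (L 0) \<and>
     (\<forall>k. 1 \<le> k \<and> k \<le> K \<longrightarrow>
        L k = L (k - 1) - gap_select t (\<Omega> *\<^sub>v x (k - 1)) (L (k - 1)) \<and>
        x k \<in> gap_solutions M \<Omega> y (L k))"

(* The borderline selection factor. If t equals the norm c below exactly, a coefficient indexed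
   by the cosupport can tie with the threshold, be discarded, and leave a problem
   with several minimizers. Example: M = (1 0), y = (1), N = (0 1), cosupport row (0 1), other
   row (1 1/2), target signal (1 0), c = t = 1/2. The first estimate is (1, -2/5) with
   coefficients -2/5 (cosupport) and 4/5; both reach t * 4/5, so no row is left after
   the single iteration and every (1, s) is a minimizer. Hence "x k = x0" can only be
   concluded for t > c; for t = c the alternative is that x0 is one of several minimizers. *)

end

theory Submission
  imports Defs
begin

text \<open>
  On the null space of \<open>M\<close> the functional \<open>z \<mapsto> (\<Omega> z)\<^sub>j\<close>, \<open>j \<notin> \<Lambda>\<close>, is represented with respect to the
  inner product \<open>\<Sum>i\<in>\<Lambda>. (\<Omega> z)\<^sub>i (\<Omega> w)\<^sub>i\<close> by a vector \<open>r\<^sub>j\<close>, and \<open>(\<Omega> r\<^sub>j)\<^sub>i\<close> is the \<open>(i, j)\<close> entry of the matrix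
  whose norm is \<open>c\<close>. As long as the remaining set \<open>L\<close> contains \<open>\<Lambda>\<close>, the normal equations of the
  constrained least-squares problem express the coefficients on the cosupport as
  \<open>\<alpha>\<^sub>i = - (\<Sum>j\<in>L - \<Lambda>. \<alpha>\<^sub>j (\<Omega> r\<^sub>j)\<^sub>i)\<close>; hence they are at most \<open>c\<close> times the largest coefficient
  outside, and for \<open>t > c\<close> only indices outside \<open>\<Lambda>\<close> are discarded, at least one per iteration.
  For \<open>t = c\<close> indices of \<open>\<Lambda>\<close> may be lost as well, but the formula for \<open>\<alpha>\<^sub>i\<close> survives if \<open>(\<Omega> r\<^sub>j)\<^sub>i = 0\<close> for
  all lost \<open>i\<close> and all remaining \<open>j\<close>, and this property is preserved by every iteration.
\<close>

subsection \<open>Matrices\<close>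

lemma abs_index_le_linf_norm: "i < dim_vec v \<Longrightarrow> \<bar>v $ i\<bar> \<le> linf_norm v"
  unfolding linf_norm_def by (intro Max_ge) auto

lemma linf_norm_le:
  assumes "0 \<le> b" "\<And>i. i < dim_vec v \<Longrightarrow> \<bar>v $ i\<bar> \<le> b"
  shows "linf_norm v \<le> b"
  unfolding linf_norm_def using assms by (subst Max_le_iff) auto

text \<open>The sign vector of row \<open>i\<close> has norm at most 1, and entry \<open>i\<close>
  of its image is the absolute row sum.\<close>

lemma row_sum_le_linf_opnorm:
  assumes A: "A \<in> carrier_mat r s" and i: "i < r"
  shows "(\<Sum>j<s. \<bar>A $$ (i, j)\<bar>) \<le> linf_opnorm A"
proof -
  let ?X = "{linf_norm (A *\<^sub>v v) | v. v \<in> carrier_vec (dim_col A) \<and> linf_norm v \<le> 1}"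
  \<comment> \<open>A crude bound, the sum of all absolute entries: it makes the set
    \<open>?X\<close> bounded above, so that \<open>Sup\<close> dominates its members.\<close>
  define b where "b = (\<Sum>i<r. \<Sum>j<s. \<bar>A $$ (i, j)\<bar>)"
  have Av: "(A *\<^sub>v v) $ k = (\<Sum>j<s. A $$ (k, j) * v $ j)" if "v \<in> carrier_vec s" "k < r" for v k
    using A that by (auto simp: scalar_prod_def atLeast0LessThan intro!: sum.cong)
  have "linf_norm (A *\<^sub>v v) \<le> b" if v: "v \<in> carrier_vec s" "linf_norm v \<le> 1" for v
  proof (rule linf_norm_le)
    show "0 \<le> b" by (auto simp: b_def intro!: sum_nonneg)
    fix k assume "k < dim_vec (A *\<^sub>v v)"
    then have k: "k < r" using A by auto
    have v1: "\<bar>v $ j\<bar> \<le> 1" if "j < s" for j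
      using abs_index_le_linf_norm[of j v] v that by auto
    have "\<bar>(A *\<^sub>v v) $ k\<bar> \<le> (\<Sum>j<s. \<bar>A $$ (k, j) * v $ j\<bar>)"
      unfolding Av[OF v(1) k] by (rule sum_abs)
    also have "\<dots> \<le> (\<Sum>j<s. \<bar>A $$ (k, j)\<bar>)"
      using v1 by (intro sum_mono) (auto simp: abs_mult mult_right_le_one_le)
    also have "\<dots> \<le> b"
      unfolding b_def using k
      by (intro member_le_sum[where f = "\<lambda>i. \<Sum>j<s. \<bar>A $$ (i, j)\<bar>"]) (auto intro: sum_nonneg)
    finally show "\<bar>(A *\<^sub>v v) $ k\<bar> \<le> b" .
  qed
  then have bdd: "bdd_above ?X" using A by (intro bdd_aboveI[of _ b]) auto
  define v where "v = vec s (\<lambda>j. sgn (A $$ (i, j)))"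
  have v: "v \<in> carrier_vec s" by (simp add: v_def)
  have "linf_norm v \<le> 1" by (rule linf_norm_le) (auto simp: v_def sgn_if)
  then have "linf_norm (A *\<^sub>v v) \<in> ?X" using v A by auto
  then have "linf_norm (A *\<^sub>v v) \<le> linf_opnorm A"
    unfolding linf_opnorm_def by (rule cSup_upper[OF _ bdd])
  moreover have "(A *\<^sub>v v) $ i = (\<Sum>j<s. \<bar>A $$ (i, j)\<bar>)"
    unfolding Av[OF v i] by (rule sum.cong) (auto simp: v_def abs_sgn)
  moreover have "\<bar>(A *\<^sub>v v) $ i\<bar> \<le> linf_norm (A *\<^sub>v v)"
    using A i by (intro abs_index_le_linf_norm) auto
  ultimately show ?thesis by linarith
qed

section \<open>Row submatrices as sums over index sets\<close>

text \<open>\<open>submatrix\<close> renumbers the selected rows by position; this bijection turns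
  sums over positions into sums over the original row indices.\<close>

lemma bij_betw_pick:
  assumes "finite I"
  shows "bij_betw (pick I) {..<card I} I"
proof -
  have "inj_on (pick I) {..<card I}"
    by (rule linorder_inj_onI) (auto dest: pick_mono_le)
  moreover have "pick I ` {..<card I} = I"
  proof (rule card_subset_eq[OF assms])
    show "pick I ` {..<card I} \<subseteq> I" using pick_in_set_le by auto
  qed (simp add: card_image calculation)
  ultimately show ?thesis by (simp add: bij_betw_def)
qed

lemma pick_surj:
  assumes "finite I" "i \<in> I"
  obtains a where "a < card I" "pick I a = i"
proof -
  have "i \<in> pick I ` {..<card I}" using bij_betw_pick[OF assms(1)] assms(2) by (simp add: bij_betw_def)
  then show thesis using that by auto
qed

lemma row_submatrix_carrier:
  assumes "A \<in> carrier_mat p d" "I \<subseteq> {0..<p}"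
  shows "row_submatrix A I \<in> carrier_mat (card I) d"
proof -
  have "{i. i < p \<and> i \<in> I} = I" using assms by auto
  then show ?thesis using assms by (auto simp: dim_submatrix intro!: carrier_matI)
qed

lemma row_row_submatrix:
  assumes A: "A \<in> carrier_mat p d" and I: "I \<subseteq> {0..<p}" and k: "k < card I"
  shows "row (row_submatrix A I) k = row A (pick I k)"
proof -
  have eq: "{i. i < p \<and> i \<in> I} = I" using I by auto
  have "pick I k < p" using pick_in_set_le[OF k] I by auto
  then show ?thesis
    using row_submatrix_carrier[OF A I] A k
    by (intro eq_vecI) (auto simp: submatrix_index pick_UNIV eq)
qed

lemma scalar_prod_row_submatrix:
  assumes A: "A \<in> carrier_mat p d" and I: "I \<subseteq> {0..<p}"
  shows "(row_submatrix A I *\<^sub>v u) \<bullet> (row_submatrix A I *\<^sub>v w) = (\<Sum>i\<in>I. (row A i \<bullet> u) * (row A i \<bullet> w))"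
proof -
  have "finite I" using I by (rule finite_subset) auto
  have "(row_submatrix A I *\<^sub>v u) \<bullet> (row_submatrix A I *\<^sub>v w)
      = (\<Sum>k<card I. (row A (pick I k) \<bullet> u) * (row A (pick I k) \<bullet> w))"
    unfolding scalar_prod_def[of "row_submatrix A I *\<^sub>v u"]
    using row_submatrix_carrier[OF A I]
    by (intro sum.cong) (auto simp: atLeast0LessThan row_row_submatrix[OF A I])
  also have "\<dots> = (\<Sum>i\<in>I. (row A i \<bullet> u) * (row A i \<bullet> w))"
    by (rule sum.reindex_bij_betw[OF bij_betw_pick[OF \<open>finite I\<close>]])
  finally show ?thesis .
qed

section \<open>Normal equations of the constrained least-squares problem\<close>

text \<open>Moving from \<open>x\<close> along a kernel vector keeps the constraint. On this line
  the objective is a quadratic in the step size with its minimum at 0, so its linear coefficient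
  vanishes.\<close>

lemma gap_solution_stationary:
  assumes M: "M \<in> carrier_mat m d" and A: "A \<in> carrier_mat p d" and I: "I \<subseteq> {0..<p}"
    and x: "x \<in> gap_solutions M A y I" and w: "w \<in> mat_kernel M"
  shows "(\<Sum>i\<in>I. (row A i \<bullet> x) * (row A i \<bullet> w)) = 0"
proof -
  let ?R = "row_submatrix A I"
  have R: "?R \<in> carrier_mat (card I) d" by (rule row_submatrix_carrier[OF A I])
  have xc: "x \<in> carrier_vec d" and yx: "y = M *\<^sub>v x"
    and min: "\<And>z. z \<in> carrier_vec d \<Longrightarrow> y = M *\<^sub>v z \<Longrightarrow> (?R *\<^sub>v x) \<bullet> (?R *\<^sub>v x) \<le> (?R *\<^sub>v z) \<bullet> (?R *\<^sub>v z)"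
    using x M by (auto simp: gap_solutions_def is_arg_min_linorder)
  have wc: "w \<in> carrier_vec d" and Mw: "M *\<^sub>v w = 0\<^sub>v m" using mat_kernelD[OF M w] by auto
  define a b where "a = (\<Sum>i\<in>I. (row A i \<bullet> x) * (row A i \<bullet> w))"
    and "b = (\<Sum>i\<in>I. (row A i \<bullet> w) * (row A i \<bullet> w))"
  have quad: "0 \<le> 2 * s * a + s * s * b" for s
  proof -
    let ?z = "x + s \<cdot>\<^sub>v w"
    have "s \<cdot>\<^sub>v 0\<^sub>v m = 0\<^sub>v m" by (rule eq_vecI) auto
    then have "M *\<^sub>v ?z = M *\<^sub>v x"
      using M xc wc Mw by (simp add: mult_add_distrib_mat_vec[OF M] mult_mat_vec[OF M])
    then have "(?R *\<^sub>v x) \<bullet> (?R *\<^sub>v x) \<le> (?R *\<^sub>v ?z) \<bullet> (?R *\<^sub>v ?z)"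
      using xc wc yx by (intro min) auto
    moreover have "row A i \<bullet> ?z = row A i \<bullet> x + s * (row A i \<bullet> w)" if "i \<in> I" for i
    proof -
      have row: "row A i \<in> carrier_vec d" using A by auto
      have "row A i \<bullet> ?z = row A i \<bullet> x + row A i \<bullet> (s \<cdot>\<^sub>v w)"
        using scalar_prod_add_distrib[OF row xc] wc by simp
      then show ?thesis using row wc by simp
    qed
    then have "(\<Sum>i\<in>I. (row A i \<bullet> ?z) * (row A i \<bullet> ?z))
        = (\<Sum>i\<in>I. (row A i \<bullet> x) * (row A i \<bullet> x)) + 2 * s * a + s * s * b"
      unfolding a_def b_def sum_distrib_left sum.distrib[symmetric]
      by (intro sum.cong) (auto simp: algebra_simps)
    ultimately show ?thesis unfolding scalar_prod_row_submatrix[OF A I] by linarith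
  qed
  have "b \<ge> 0" unfolding b_def by (intro sum_nonneg) auto
  \<comment> \<open>The decisive step sizes: for \<open>b = 0\<close> the increment is linear and
    \<open>s = - a\<close> gives \<open>- 2 * a * a\<close>; otherwise the vertex
    \<open>s = - a / b\<close> of the parabola gives \<open>- (a * a) / b\<close>.\<close>
  have "a = 0"
  proof (cases "b = 0")
    case True
    then show ?thesis using quad[of "- a"] by (auto simp: mult_le_0_iff)
  next
    case False
    have "2 * (- a / b) * a + (- a / b) * (- a / b) * b = - (a * a) / b"
      using False by (simp add: field_simps)
    then have "a * a / b \<le> 0" using quad[of "- a / b"] by simp
    then show ?thesis using False \<open>b \<ge> 0\<close>
      by (auto simp: divide_le_0_iff mult_le_0_iff)
  qed
  then show ?thesis by (simp add: a_def)
qed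

section \<open>Full column rank and bases of the kernel\<close>

text \<open>The rank is at most the number of different columns. Distinctness has to be derived
  because linear independence is a property of the set of columns and does not see
  repetitions.\<close>

lemma (in vec_space) full_rank_distinct_cols:
  assumes A: "A \<in> carrier_mat n nc" and "rank A = nc"
  shows "distinct (cols A)"
proof (rule ccontr)
  assume "\<not> distinct (cols A)"
  then have "card (set (cols A)) < length (cols A)"
    by (metis card_distinct card_length le_neq_implies_less)
  moreover have "rank A \<le> card (set (cols A))"
  proof -
    obtain S where S: "finite S" "maximal S (\<lambda>T. T \<subseteq> set (cols A) \<and> lin_indpt T)"
      using maximal_exists_superset[of "set (cols A)" "\<lambda>T. T \<subseteq> set (cols A) \<and> lin_indpt T" "{}"]
      by (auto simp: lin_dep_def)
    then have "S \<subseteq> set (cols A)" by (simp add: maximal_def)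
    then show ?thesis using rank_card_indpt[OF A S(2)] by (simp add: card_mono)
  qed
  ultimately show False using assms by simp
qed

lemma (in vec_space) full_rank_kernel:
  assumes A: "A \<in> carrier_mat n nc" and rank: "rank A = nc"
    and v: "v \<in> carrier_vec nc" "A *\<^sub>v v = 0\<^sub>v n"
  shows "v = 0\<^sub>v nc"
  using lin_depI[OF A v(1) _ v(2)] full_rank_lin_indpt[OF A rank] full_rank_distinct_cols[OF A rank]
  by blast

lemma (in vec_space) full_rank_cols_le:
  assumes A: "A \<in> carrier_mat n nc" and rank: "rank A = nc"
  shows "nc \<le> n"
proof -
  have dist: "distinct (cols A)" by (rule full_rank_distinct_cols[OF A rank])
  have "card (set (cols A)) = nc" using dist A by (simp add: distinct_card)
  moreover have "set (cols A) \<subseteq> carrier_vec n" using A cols_dim by blast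
  ultimately show ?thesis
    using li_le_dim(2)[OF fin_dim _ full_rank_lin_indpt[OF A rank dist]] by (simp add: dim_is_n)
qed

text \<open>The basis lives in the kernel as a vector space of its own. \<open>span_same\<close>
  moves its span to the ambient space, where distinct columns let linear combinations be read as
  matrix-vector products.\<close>

lemma kernel_basis_cols:
  assumes M: "M \<in> carrier_mat m d" and B: "B \<in> carrier_mat d n" and dist: "distinct (cols B)"
    and basis: "kernel.basis d M (set (cols B))"
  shows "mat_kernel M = {B *\<^sub>v z | z. z \<in> carrier_vec n}"
proof -
  interpret kernel m d M by unfold_locales (rule M)
  have sub: "set (cols B) \<subseteq> mat_kernel M" and span: "span (set (cols B)) = mat_kernel M"
    using basis by (auto simp: Ker.basis_def)
  have subd: "set (cols B) \<subseteq> carrier_vec d" using B cols_dim by blast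
  have "NC.span (set (cols B)) = {B *\<^sub>v z | z. z \<in> carrier_vec n}" (is "_ = ?R")
  proof (intro equalityI subsetI)
    fix v assume "v \<in> NC.span (set (cols B))"
    then obtain a where "v = NC.lincomb a (set (cols B))"
      using NC.finite_span[OF finite_set subd] by auto
    then have "v = B *\<^sub>v vec n (\<lambda>i. a (col B i))" using NC.mat_mult_eq_lincomb[OF B dist] by simp
    then show "v \<in> ?R" by auto
  next
    fix v assume "v \<in> ?R"
    then obtain z where "z \<in> carrier_vec n" "v = B *\<^sub>v z" by auto
    then have "v = NC.lincomb (\<lambda>a. z $ find_first a (cols B)) (set (cols B))"
      using NC.lincomb_eq_mat_mult[OF B _ dist] by simp
    then show "v \<in> NC.span (set (cols B))" using NC.finite_span[OF finite_set subd] by auto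
  qed
  then show ?thesis using span span_same[OF sub] by simp
qed

section \<open>The pseudo-inverse of a matrix of full row rank\<close>

text \<open>If the Gram matrix kills \<open>v\<close>, the squared length of
  \<open>B *\<^sub>v v\<close> is 0. Hence the square Gram matrix is as injective as
  \<open>B\<close>, and so invertible.\<close>

lemma gram_inverse:
  assumes B: "(B :: real mat) \<in> carrier_mat l n"
    and inj: "\<And>v. v \<in> carrier_vec n \<Longrightarrow> B *\<^sub>v v = 0\<^sub>v l \<Longrightarrow> v = 0\<^sub>v n"
  obtains H where "H \<in> carrier_mat n n" "B\<^sup>T * B * H = 1\<^sub>m n"
proof -
  let ?G = "B\<^sup>T * B"
  have G: "?G \<in> carrier_mat n n" using B by auto
  have "det ?G \<noteq> 0"
  proof
    assume "det ?G = 0"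
    then obtain v where v: "v \<in> carrier_vec n" "v \<noteq> 0\<^sub>v n" "?G *\<^sub>v v = 0\<^sub>v n"
      using det_0_iff_vec_prod_zero_field[OF G] by auto
    have Bv: "B *\<^sub>v v \<in> carrier_vec l" using B v by auto
    have "(B *\<^sub>v v) \<bullet> (B *\<^sub>v v) = (B\<^sup>T *\<^sub>v (B *\<^sub>v v)) \<bullet> v"
      using transpose_vec_mult_scalar[OF B v(1) Bv] by simp
    also have "B\<^sup>T *\<^sub>v (B *\<^sub>v v) = 0\<^sub>v n"
      using assoc_mult_mat_vec[OF _ B v(1), of "B\<^sup>T" n] v(3) B by simp
    finally have "(B *\<^sub>v v) \<bullet> (B *\<^sub>v v) = 0" using v by simp
    then have "B *\<^sub>v v = 0\<^sub>v l"
      using conjugate_square_eq_0_vec[OF Bv] by simp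
    with inj v show False by auto
  qed
  then have "?G \<in> Units (ring_mat TYPE(real) n ())" by (rule det_non_zero_imp_unit[OF G])
  then show thesis using that by (auto simp: Units_def ring_mat_def)
qed

lemma pseudo_inverse_eqI: "is_pseudo_inverse A X \<Longrightarrow> pseudo_inverse A = X"
  unfolding pseudo_inverse_def by (blast intro: the_equality is_pseudo_inverse_unique)

text \<open>\<open>H\<close> is the inverse Gram matrix and \<open>B * H\<close> a right inverse of
  \<open>B\<^sup>T\<close>, which gives three of the Penrose equations. The fourth, symmetry of
  \<open>B * H * B\<^sup>T\<close>, reduces to the symmetry of \<open>H\<close>.\<close>

lemma pseudo_inverse_transpose:
  assumes B: "B \<in> carrier_mat l n" and H: "H \<in> carrier_mat n n"
    and GH: "B\<^sup>T * B * H = 1\<^sub>m n"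
  shows "pseudo_inverse (B\<^sup>T) = B * H"
proof (rule pseudo_inverse_eqI)
  have BT: "B\<^sup>T \<in> carrier_mat n l" and BH: "B * H \<in> carrier_mat l n" using B H by auto
  have G: "B\<^sup>T * B \<in> carrier_mat n n" using B by auto
  have AX: "B\<^sup>T * (B * H) = 1\<^sub>m n" using GH assoc_mult_mat[OF BT B H] by simp
  have "(B\<^sup>T * B)\<^sup>T = B\<^sup>T * B" using transpose_mult[OF BT B] by simp
  then have "H\<^sup>T * (B\<^sup>T * B) = 1\<^sub>m n"
    using transpose_mult[OF G H] GH by simp
  \<comment> \<open>\<open>H\<^sup>T\<close> is a left inverse of the symmetric Gram matrix and
    therefore equals the right inverse \<open>H\<close>.\<close>
  then have HT: "H\<^sup>T = H"
    using assoc_mult_mat[of "H\<^sup>T" n n "B\<^sup>T * B" n H n] G H GH by simp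
  have "(B * H * B\<^sup>T)\<^sup>T = B * (B * H)\<^sup>T" using transpose_mult[OF BH BT] by simp
  also have "\<dots> = B * (H * B\<^sup>T)" using transpose_mult[OF B H] HT by simp
  finally have sym: "(B * H * B\<^sup>T)\<^sup>T = B * H * B\<^sup>T" using assoc_mult_mat[OF B H BT] by simp
  have "B * H * B\<^sup>T * (B * H) = B * H" using assoc_mult_mat[OF BH BT BH] AX right_mult_one_mat[OF BH] by simp
  then show "is_pseudo_inverse (B\<^sup>T) (B * H)"
    using AX BT BH sym by (auto simp: is_pseudo_inverse_def)
qed

subsection \<open>Greedy selection and representers\<close>

text \<open>The selection argument without matrices. \<open>V\<close> models the sequences of
  coefficients of kernel vectors of \<open>M\<close>, \<open>C\<close> the row indices outside the
  cosupport, and \<open>r j\<close> the coefficients of the representer of index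
  \<open>j\<close>.\<close>

locale dual_representers =
  fixes V :: "(nat \<Rightarrow> real) set" and \<Lambda> C :: "nat set" and r :: "nat \<Rightarrow> nat \<Rightarrow> real" and c :: real
  assumes fin: "finite \<Lambda>" "finite C" and disjoint: "\<Lambda> \<inter> C = {}"
    and add: "f \<in> V \<Longrightarrow> g \<in> V \<Longrightarrow> (\<lambda>i. f i + g i) \<in> V"
    and scale: "f \<in> V \<Longrightarrow> (\<lambda>i. s * f i) \<in> V"
    and rep_in: "j \<in> C \<Longrightarrow> r j \<in> V"
    and represents: "j \<in> C \<Longrightarrow> f \<in> V \<Longrightarrow> (\<Sum>i\<in>\<Lambda>. r j i * f i) = f j"
    and row_sum_le: "i \<in> \<Lambda> \<Longrightarrow> (\<Sum>j\<in>C. \<bar>r j i\<bar>) \<le> c"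
    and c_less_1: "c < 1"
begin

text \<open>The first conjunct reflects that an estimate differs from the target signal by a kernel
  vector, and that the target has zero coefficients on \<Lambda>; the second is the normal
  equations.\<close>

definition stationary :: "nat set \<Rightarrow> (nat \<Rightarrow> real) \<Rightarrow> bool" where
  "stationary I a \<longleftrightarrow> (\<exists>e\<in>V. \<forall>i\<in>\<Lambda>. a i = e i) \<and> (\<forall>f\<in>V. (\<Sum>i\<in>I. a i * f i) = 0)"

text \<open>The invariant that covers the borderline factor; its second condition is vacuous as long
  as no index of \<Lambda> has been lost.\<close>

definition decoupled :: "nat set \<Rightarrow> bool" where
  "decoupled I \<longleftrightarrow> I \<subseteq> \<Lambda> \<union> C \<and> (\<forall>i\<in>\<Lambda> - I. \<forall>j\<in>I - \<Lambda>. r j i = 0)"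

lemma lincomb_in:
  assumes "finite S" "S \<subseteq> C" "e \<in> V"
  shows "(\<lambda>i. e i + (\<Sum>j\<in>S. a j * r j i)) \<in> V"
  using assms
proof (induction S rule: finite_induct)
  case (insert j S)
  then have "(\<lambda>i. (e i + (\<Sum>j\<in>S. a j * r j i)) + a j * r j i) \<in> V"
    using rep_in by (intro add[of "\<lambda>i. e i + (\<Sum>j\<in>S. a j * r j i)"] scale) auto
  with insert show ?case by (simp add: algebra_simps)
qed simp

text \<open>The normal equations are tested with \<open>g\<close>, the kernel part \<open>e\<close>
  plus the combination of representers weighted by the outside coefficients. The sum of
  \<open>g i * g i\<close> over the remaining cosupport then equals the sum of
  \<open>a i * g i\<close> over \<open>I\<close>, which is 0, so \<open>g\<close> vanishes
  there.\<close>

lemma cosupport_coeff: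
  assumes st: "stationary I a" and dec: "decoupled I" and i: "i \<in> \<Lambda>" "i \<in> I"
  shows "a i = - (\<Sum>j\<in>I - \<Lambda>. a j * r j i)"
proof -
  define S where "S = I - \<Lambda>"
  have I: "I \<subseteq> \<Lambda> \<union> C" and zero: "\<And>i j. i \<in> \<Lambda> - I \<Longrightarrow> j \<in> S \<Longrightarrow> r j i = 0"
    using dec by (auto simp: decoupled_def S_def)
  have finI: "finite I" using I fin by (auto intro: finite_subset)
  have S: "finite S" "S \<subseteq> C" using I finI by (auto simp: S_def)
  obtain e where e: "e \<in> V" "\<And>i. i \<in> \<Lambda> \<Longrightarrow> a i = e i"
    and opt: "\<And>f. f \<in> V \<Longrightarrow> (\<Sum>i\<in>I. a i * f i) = 0"
    using st by (auto simp: stationary_def)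
  define g where "g = (\<lambda>i. e i + (\<Sum>j\<in>S. a j * r j i))"
  have g: "g \<in> V" unfolding g_def using S e by (intro lincomb_in)
  have split: "(\<Sum>i\<in>I. a i * g i) = (\<Sum>i\<in>\<Lambda> \<inter> I. a i * g i) + (\<Sum>j\<in>S. a j * g j)"
    using sum.subset_diff[of "\<Lambda> \<inter> I" I "\<lambda>i. a i * g i"] finI
    by (simp add: S_def Diff_Int add.commute)
  \<comment> \<open>Decoupling enters here: the lost indices contribute nothing, so the truncated
    sum still represents evaluation at \<open>j\<close>.\<close>
  have rep: "(\<Sum>i\<in>\<Lambda> \<inter> I. r j i * g i) = g j" if "j \<in> S" for j
  proof -
    have "(\<Sum>i\<in>\<Lambda> \<inter> I. r j i * g i) = (\<Sum>i\<in>\<Lambda>. r j i * g i)"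
      using zero that fin by (intro sum.mono_neutral_left) auto
    then show ?thesis using represents[of j g] that g S by auto
  qed
  have "(\<Sum>i\<in>\<Lambda> \<inter> I. g i * g i) = (\<Sum>i\<in>\<Lambda> \<inter> I. a i * g i) + (\<Sum>i\<in>\<Lambda> \<inter> I. \<Sum>j\<in>S. a j * (r j i * g i))"
    unfolding sum.distrib[symmetric]
    by (rule sum.cong) (auto simp: g_def e(2)[symmetric] algebra_simps sum_distrib_left)
  also have "(\<Sum>i\<in>\<Lambda> \<inter> I. \<Sum>j\<in>S. a j * (r j i * g i)) = (\<Sum>j\<in>S. a j * g j)"
    by (subst sum.swap) (simp add: sum_distrib_left[symmetric] rep)
  also have "(\<Sum>i\<in>\<Lambda> \<inter> I. a i * g i) + (\<Sum>j\<in>S. a j * g j) = 0"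
    using opt[OF g] split by simp
  finally have "g i * g i = 0"
    using fin i by (subst (asm) sum_nonneg_eq_0_iff) auto
  then show ?thesis using e(2)[OF i(1)] by (simp add: g_def S_def)
qed

text \<open>The triangle inequality and the row sum bound, with the slack of one index
  \<open>j\<close> kept. For a maximal \<open>j\<close> the slack is 0; for a smaller one it decides
  the borderline case.\<close>

lemma cosupport_coeff_le:
  assumes st: "stationary I a" and dec: "decoupled I" and i: "i \<in> \<Lambda>" "i \<in> I"
    and b: "\<And>j. j \<in> I - \<Lambda> \<Longrightarrow> \<bar>a j\<bar> \<le> b" and j: "j \<in> I - \<Lambda>"
  shows "\<bar>a i\<bar> + (b - \<bar>a j\<bar>) * \<bar>r j i\<bar> \<le> c * b"
proof -
  define S where "S = I - \<Lambda>"
  have S: "S \<subseteq> C" "finite S" using dec fin by (auto simp: decoupled_def S_def intro: finite_subset)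
  have b0: "b \<ge> 0" using b[OF j] by linarith
  have "\<bar>a i\<bar> \<le> (\<Sum>j\<in>S. \<bar>a j\<bar> * \<bar>r j i\<bar>)"
    unfolding cosupport_coeff[OF st dec i] abs_minus_cancel S_def
    by (rule order_trans[OF sum_abs]) (simp add: abs_mult)
  also have "\<dots> = \<bar>a j\<bar> * \<bar>r j i\<bar> + (\<Sum>j\<in>S - {j}. \<bar>a j\<bar> * \<bar>r j i\<bar>)"
    using S j by (intro sum.remove) (auto simp: S_def)
  also have "(\<Sum>j\<in>S - {j}. \<bar>a j\<bar> * \<bar>r j i\<bar>) \<le> (\<Sum>j\<in>S - {j}. b * \<bar>r j i\<bar>)"
    using b by (intro sum_mono mult_right_mono) (auto simp: S_def)
  also have "\<dots> = (\<Sum>j\<in>S. b * \<bar>r j i\<bar>) - b * \<bar>r j i\<bar>"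
    using S j by (subst sum.remove[of S j]) (auto simp: S_def)
  also have "(\<Sum>j\<in>S. b * \<bar>r j i\<bar>) \<le> b * c"
  proof -
    have "(\<Sum>j\<in>S. \<bar>r j i\<bar>) \<le> (\<Sum>j\<in>C. \<bar>r j i\<bar>)" using S fin by (intro sum_mono2) auto
    also have "\<dots> \<le> c" by (rule row_sum_le[OF i(1)])
    finally show ?thesis using b0 by (simp add: sum_distrib_left[symmetric] mult_left_mono)
  qed
  finally show ?thesis by (simp add: algebra_simps)
qed

text \<open>By \<open>c < 1\<close>, coefficients on the cosupport cannot exceed the largest one
  outside, so the selection threshold is governed by the outside indices.\<close>

lemma Max_outside_cosupport:
  assumes st: "stationary I a" and dec: "decoupled I" and ne: "I - \<Lambda> \<noteq> {}"
  obtains j where "j \<in> I - \<Lambda>" "\<bar>a j\<bar> = Max ((\<lambda>j. \<bar>a j\<bar>) ` I)" "\<And>i. i \<in> I \<Longrightarrow> \<bar>a i\<bar> \<le> \<bar>a j\<bar>"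
proof -
  have finI: "finite I" using dec fin by (auto simp: decoupled_def intro: finite_subset)
  define b where "b = Max ((\<lambda>j. \<bar>a j\<bar>) ` (I - \<Lambda>))"
  have "b \<in> (\<lambda>j. \<bar>a j\<bar>) ` (I - \<Lambda>)"
    unfolding b_def using finI ne by (intro Max_in) auto
  then obtain j where j: "j \<in> I - \<Lambda>" "\<bar>a j\<bar> = b" by auto
  have le: "\<bar>a i\<bar> \<le> b" if "i \<in> I - \<Lambda>" for i
    unfolding b_def using finI that by (intro Max_ge) auto
  have b0: "b \<ge> 0" using j by auto
  have all: "\<bar>a i\<bar> \<le> b" if "i \<in> I" for i
  proof (cases "i \<in> \<Lambda>")
    case True
    have "\<bar>a i\<bar> \<le> c * b" using cosupport_coeff_le[OF st dec True that le j(1)] j(2) by simp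
    also have "\<dots> \<le> b" using b0 c_less_1 by (simp add: mult_le_cancel_right2)
    finally show ?thesis .
  qed (use le that in auto)
  have "Max ((\<lambda>j. \<bar>a j\<bar>) ` I) = b"
    using finI j all by (intro Max_eqI) auto
  with j all show thesis by (intro that[of j]) auto
qed

lemma select_outside_cosupport:
  assumes "stationary I (($) v)" "decoupled I" "I - \<Lambda> \<noteq> {}" "t \<le> 1"
  shows "gap_select t v I - \<Lambda> \<noteq> {}"
proof -
  obtain j where j: "j \<in> I - \<Lambda>" "\<bar>v $ j\<bar> = Max ((\<lambda>j. \<bar>v $ j\<bar>) ` I)"
    using Max_outside_cosupport[OF assms(1-3)] by blast
  have "t * \<bar>v $ j\<bar> \<le> \<bar>v $ j\<bar>" using assms(4) by (simp add: mult_le_cancel_right2)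
  then have "j \<in> gap_select t v I - \<Lambda>" using j by (auto simp: gap_select_def)
  then show ?thesis by blast
qed

text \<open>At the borderline \<open>t = c\<close> an index \<open>i\<close> of the cosupport may be discarded. Then the
  row sum bound is attained at \<open>i\<close>, so that every \<open>j\<close> with \<open>r j i \<noteq> 0\<close> carries a maximal
  coefficient and is discarded too.\<close>

lemma decoupled_step:
  assumes st: "stationary I (($) v)" and dec: "decoupled I" and t: "c \<le> t"
  shows "decoupled (I - gap_select t v I)"
  unfolding decoupled_def
proof (intro conjI ballI)
  show "I - gap_select t v I \<subseteq> \<Lambda> \<union> C" using dec by (auto simp: decoupled_def)
next
  fix i j
  assume i: "i \<in> \<Lambda> - (I - gap_select t v I)" and j: "j \<in> I - gap_select t v I - \<Lambda>"
  show "r j i = 0"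
  proof (cases "i \<in> I")
    case False
    then show ?thesis using dec i j by (auto simp: decoupled_def)
  next
    case True
    define b where "b = Max ((\<lambda>j. \<bar>v $ j\<bar>) ` I)"
    have "I - \<Lambda> \<noteq> {}" using j by blast
    then obtain k where "\<bar>v $ k\<bar> = b" and le: "\<And>i. i \<in> I \<Longrightarrow> \<bar>v $ i\<bar> \<le> b"
      unfolding b_def using Max_outside_cosupport[OF st dec] by metis
    have vi: "\<bar>v $ i\<bar> \<ge> t * b" and vj: "\<bar>v $ j\<bar> < t * b"
      using True i j by (auto simp: gap_select_def b_def)
    have b: "b \<ge> 0" using le[of j] j by auto
    have *: "\<bar>v $ i\<bar> + (b - \<bar>v $ j\<bar>) * \<bar>r j i\<bar> \<le> c * b"
      using i j True le by (intro cosupport_coeff_le[OF st dec]) auto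
    have cb: "c * b \<le> t * b" using t b by (intro mult_right_mono)
    have "c * b \<le> b" using b c_less_1 by (simp add: mult_le_cancel_right2)
    moreover have "0 \<le> (b - \<bar>v $ j\<bar>) * \<bar>r j i\<bar>" using le[of j] j by auto
    \<comment> \<open>The chain \<open>t * b\<close> \<le> |v i| \<le> \<open>c * b\<close> - slack
      \<le> \<open>t * b\<close> - slack forces the slack to be 0, while |v j| <
      \<open>t * b\<close> \<le> \<open>c * b\<close> \<le> \<open>b\<close> makes its first factor
      positive.\<close>
    ultimately have lt: "\<bar>v $ j\<bar> < b" and "(b - \<bar>v $ j\<bar>) * \<bar>r j i\<bar> = 0"
      using vi vj cb * by linarith+
    then show ?thesis by simp
  qed
qed

text \<open>The nonzero coefficient at \<open>i0\<close> makes the maximum \<open>b\<close>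
  positive, so \<open>c * b\<close> lies strictly below the threshold. If all coefficients were 0,
  the threshold would be 0 and everything would be discarded.\<close>

lemma select_disjoint_cosupport:
  assumes st: "stationary I (($) v)" and dec: "decoupled I" and ne: "I - \<Lambda> \<noteq> {}" and t: "c < t"
    and nz: "i0 \<in> \<Lambda> \<inter> I" "v $ i0 \<noteq> 0"
  shows "gap_select t v I \<inter> \<Lambda> = {}"
proof -
  define b where "b = Max ((\<lambda>j. \<bar>v $ j\<bar>) ` I)"
  obtain j where j: "j \<in> I - \<Lambda>" "\<bar>v $ j\<bar> = b" and le: "\<And>i. i \<in> I \<Longrightarrow> \<bar>v $ i\<bar> \<le> b"
    unfolding b_def using Max_outside_cosupport[OF st dec ne] by metis
  have "b > 0" using le[of i0] nz by auto
  then have "c * b < t * b" using t by simp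
  moreover have "\<bar>v $ i\<bar> \<le> c * b" if "i \<in> \<Lambda>" "i \<in> I" for i
    using cosupport_coeff_le[OF st dec that, of b j] j le by auto
  ultimately show ?thesis by (fastforce simp: gap_select_def b_def)
qed

section \<open>Runs of the selection up to iteration \<open>card C\<close>\<close>

context
  fixes t :: real and L :: "nat \<Rightarrow> nat set" and v :: "nat \<Rightarrow> real vec"
  assumes t: "c \<le> t" "t \<le> 1"
    and L0: "L 0 = \<Lambda> \<union> C"
    and L_Suc: "\<And>k. k < card C \<Longrightarrow> L (Suc k) = L k - gap_select t (v k) (L k)"
    and stat: "\<And>k. k \<le> card C \<Longrightarrow> stationary (L k) (($) (v k))"
begin

lemma decoupled_run: "k \<le> card C \<Longrightarrow> decoupled (L k)"
proof (induction k)
  case 0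
  then show ?case by (auto simp: decoupled_def L0)
next
  case (Suc k)
  then show ?case using decoupled_step[OF stat _ t(1), of k] L_Suc[of k] by simp
qed

text \<open>Each iteration discards an outside index while there is one; afterwards the bound is
  just \<open>k \<le> card C\<close>.\<close>

lemma card_outside_cosupport: "k \<le> card C \<Longrightarrow> card (L k - \<Lambda>) + k \<le> card C"
proof (induction k)
  case 0
  have "L 0 - \<Lambda> = C" using disjoint by (auto simp: L0)
  then show ?case by simp
next
  case (Suc k)
  have k: "k \<le> card C" "k < card C" using Suc.prems by auto
  have fink: "finite (L k)" using decoupled_run[OF k(1)] fin
    by (auto simp: decoupled_def intro: finite_subset)
  have eq: "L (Suc k) - \<Lambda> = L k - \<Lambda> - gap_select t (v k) (L k)" using L_Suc[OF k(2)] by auto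
  show ?case
  proof (cases "L k - \<Lambda> = {}")
    case True
    then show ?thesis using Suc.prems unfolding eq by (simp only: empty_Diff card.empty)
  next
    case False
    have "L (Suc k) - \<Lambda> \<subset> L k - \<Lambda>"
      using select_outside_cosupport[OF stat[OF k(1)] decoupled_run[OF k(1)] False t(2)]
      unfolding eq by (auto simp: gap_select_def)
    then have "card (L (Suc k) - \<Lambda>) < card (L k - \<Lambda>)" using fink by (intro psubset_card_mono) auto
    then show ?thesis using Suc.IH[OF k(1)] by simp
  qed
qed

lemma run_reaches_cosupport: "L (card C) \<subseteq> \<Lambda>"
proof -
  have "finite (L (card C))" using decoupled_run[OF order_refl] fin
    by (auto simp: decoupled_def intro: finite_subset)
  then show ?thesis using card_outside_cosupport[OF order_refl] by simp
qed

text \<open>Suppose some cosupport coefficient is nonzero at every stage. Then \<Lambda> never loses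
  an index, yet after \<open>card C\<close> iterations nothing outside it is left, and the
  coefficient formula with an empty sum gives 0 on all of \<Lambda>.\<close>

lemma run_annihilates_cosupport:
  assumes "c < t"
  shows "\<exists>k\<le>card C. \<forall>i\<in>\<Lambda>. v k $ i = 0"
proof (rule ccontr)
  assume neg: "\<not> ?thesis"
  have sub: "\<Lambda> \<subseteq> L k" if "k \<le> card C" for k
    using that
  proof (induction k)
    case (Suc k)
    have k: "k \<le> card C" "k < card C" using Suc.prems by auto
    obtain i where i: "i \<in> \<Lambda>" "v k $ i \<noteq> 0" using neg k by blast
    have "i \<in> L k" using Suc.IH[OF k(1)] i by auto
    have "L k - \<Lambda> \<noteq> {}"
    proof
      assume "L k - \<Lambda> = {}"
      then have "v k $ i = 0"
        using cosupport_coeff[OF stat[OF k(1)] decoupled_run[OF k(1)] i(1) \<open>i \<in> L k\<close>]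
        by (simp only: sum.empty minus_zero)
      with i show False by simp
    qed
    from select_disjoint_cosupport[OF stat[OF k(1)] decoupled_run[OF k(1)] this assms, of i]
    show ?case using i \<open>i \<in> L k\<close> Suc.IH[OF k(1)] L_Suc[OF k(2)] by auto
  qed (simp add: L0)
  have "v (card C) $ i = 0" if "i \<in> \<Lambda>" for i
  proof -
    have "L (card C) - \<Lambda> = {}" using run_reaches_cosupport by auto
    then show ?thesis
      using cosupport_coeff[OF stat[OF order_refl] decoupled_run[OF order_refl] that] sub[OF order_refl] that
      by (simp only: sum.empty minus_zero subset_iff)
  qed
  then show False using neg by blast
qed

end

end

subsection \<open>Recovery\<close>

text \<open>With \<open>B\<close> the matrix of rows in \<Lambda> times \<open>Q\<close>, the vector
  \<open>u j\<close> solves the Gram equation with right-hand side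
  \<open>Q\<^sup>T *\<^sub>v row A j\<close>. The vectors \<open>B *\<^sub>v u j\<close> are the
  columns of the matrix in the norm, so its row sums bound the representers.\<close>

lemma pseudo_inverse_representers:
  assumes A: "A \<in> carrier_mat p d" and Q: "Q \<in> carrier_mat d n"
    and \<Lambda>: "\<Lambda> \<subseteq> {0..<p}" and C: "C \<subseteq> {0..<p}"
    and inj: "\<And>v. v \<in> carrier_vec n \<Longrightarrow> row_submatrix A \<Lambda> * Q *\<^sub>v v = 0\<^sub>v (card \<Lambda>) \<Longrightarrow> v = 0\<^sub>v n"
  shows "\<exists>u. (\<forall>j\<in>C. u j \<in> carrier_vec n) \<and>
    (\<forall>j\<in>C. \<forall>w\<in>carrier_vec n.
      (\<Sum>i\<in>\<Lambda>. (row A i \<bullet> (Q *\<^sub>v u j)) * (row A i \<bullet> (Q *\<^sub>v w))) = row A j \<bullet> (Q *\<^sub>v w)) \<and>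
    (\<forall>i\<in>\<Lambda>. (\<Sum>j\<in>C. \<bar>row A i \<bullet> (Q *\<^sub>v u j)\<bar>)
      \<le> linf_opnorm (pseudo_inverse (Q\<^sup>T * (row_submatrix A \<Lambda>)\<^sup>T) * (Q\<^sup>T * (row_submatrix A C)\<^sup>T)))"
proof -
  let ?R = "row_submatrix A \<Lambda>" and ?RC = "row_submatrix A C"
  define B where "B = ?R * Q"
  have R: "?R \<in> carrier_mat (card \<Lambda>) d" and RC: "?RC \<in> carrier_mat (card C) d"
    using row_submatrix_carrier[OF A] \<Lambda> C by blast+
  have fin: "finite \<Lambda>" "finite C" using \<Lambda> C by (auto intro: finite_subset)
  have B: "B \<in> carrier_mat (card \<Lambda>) n" and QT: "Q\<^sup>T \<in> carrier_mat n d" using R Q by (auto simp: B_def)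
  have row: "row A i \<in> carrier_vec d" for i using A by auto
  obtain H where H: "H \<in> carrier_mat n n" "B\<^sup>T * B * H = 1\<^sub>m n"
    using gram_inverse[OF B] inj unfolding B_def by blast
  define u where "u j = H *\<^sub>v (Q\<^sup>T *\<^sub>v row A j)" for j
  have u: "u j \<in> carrier_vec n" for j unfolding u_def using H QT row by auto
  have BT: "Q\<^sup>T * ?R\<^sup>T = B\<^sup>T" unfolding B_def using transpose_mult[OF R Q] by simp
  have Bv: "B *\<^sub>v w = ?R *\<^sub>v (Q *\<^sub>v w)" if "w \<in> carrier_vec n" for w
    unfolding B_def by (rule assoc_mult_mat_vec[OF R Q that])
  show ?thesis
  proof (intro exI[of _ u] conjI ballI)
    show "u j \<in> carrier_vec n" for j by (rule u)
    fix j and w :: "real vec" assume w: "w \<in> carrier_vec n"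
    have G: "B\<^sup>T * B \<in> carrier_mat n n" using B by auto
    have v: "Q\<^sup>T *\<^sub>v row A j \<in> carrier_vec n" using QT row by auto
    have "(\<Sum>i\<in>\<Lambda>. (row A i \<bullet> (Q *\<^sub>v u j)) * (row A i \<bullet> (Q *\<^sub>v w))) = (B *\<^sub>v u j) \<bullet> (B *\<^sub>v w)"
      unfolding Bv[OF u] Bv[OF w] by (rule scalar_prod_row_submatrix[OF A \<Lambda>, symmetric])
    also have "\<dots> = (B\<^sup>T *\<^sub>v (B *\<^sub>v u j)) \<bullet> w"
      using transpose_vec_mult_scalar[OF B w, of "B *\<^sub>v u j"] B u by simp
    also have "B\<^sup>T *\<^sub>v (B *\<^sub>v u j) = B\<^sup>T * B *\<^sub>v u j"
      using B u by (intro assoc_mult_mat_vec[symmetric, of _ n "card \<Lambda>"]) auto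
    also have "\<dots> = Q\<^sup>T *\<^sub>v row A j"
      unfolding u_def using assoc_mult_mat_vec[OF G H(1) v] H(2) v by simp
    also have "(Q\<^sup>T *\<^sub>v row A j) \<bullet> w = row A j \<bullet> (Q *\<^sub>v w)"
      by (rule transpose_vec_mult_scalar[OF Q w row])
    finally show "(\<Sum>i\<in>\<Lambda>. (row A i \<bullet> (Q *\<^sub>v u j)) * (row A i \<bullet> (Q *\<^sub>v w))) = row A j \<bullet> (Q *\<^sub>v w)" .
  next
    fix i assume i: "i \<in> \<Lambda>"
    define X where "X = B * H * (Q\<^sup>T * ?RC\<^sup>T)"
    have QR: "Q\<^sup>T * ?RC\<^sup>T \<in> carrier_mat n (card C)" using QT RC by auto
    have BH: "B * H \<in> carrier_mat (card \<Lambda>) n" using B H by auto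
    have X: "X \<in> carrier_mat (card \<Lambda>) (card C)" unfolding X_def using BH QR by auto
    obtain a where a: "a < card \<Lambda>" "pick \<Lambda> a = i"
      by (rule pick_surj[OF fin(1) i])
    \<comment> \<open>Positions \<open>(a, b)\<close> of \<open>X\<close> stand for the row indices
      \<open>pick \<Lambda> a\<close> and \<open>pick C b\<close>.\<close>
    have Xab: "X $$ (a, b) = row A i \<bullet> (Q *\<^sub>v u (pick C b))" if b: "b < card C" for b
    proof -
      have "col (?RC\<^sup>T) b = row A (pick C b)"
        using b RC row_row_submatrix[OF A C b] by simp
      then have "col (Q\<^sup>T * ?RC\<^sup>T) b = Q\<^sup>T *\<^sub>v row A (pick C b)"
        using col_mult2[OF QT, of "?RC\<^sup>T" "card C" b] RC b by simp
      then have "col X b = B * H *\<^sub>v (Q\<^sup>T *\<^sub>v row A (pick C b))"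
        unfolding X_def using col_mult2[OF BH QR b] by simp
      also have "\<dots> = B *\<^sub>v u (pick C b)"
        unfolding u_def using QT row by (intro assoc_mult_mat_vec[OF B H(1)]) auto
      also have "\<dots> = ?R *\<^sub>v (Q *\<^sub>v u (pick C b))" by (rule Bv[OF u])
      finally have "col X b $ a = row A (pick \<Lambda> a) \<bullet> (Q *\<^sub>v u (pick C b))"
        using R a by (simp add: row_row_submatrix[OF A \<Lambda>])
      then show ?thesis using X a b by simp
    qed
    have "(\<Sum>j\<in>C. \<bar>row A i \<bullet> (Q *\<^sub>v u j)\<bar>) = (\<Sum>b<card C. \<bar>row A i \<bullet> (Q *\<^sub>v u (pick C b))\<bar>)"
      by (rule sum.reindex_bij_betw[OF bij_betw_pick[OF fin(2)], symmetric])
    also have "\<dots> = (\<Sum>b<card C. \<bar>X $$ (a, b)\<bar>)" using Xab by simp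
    also have "\<dots> \<le> linf_opnorm X" by (rule row_sum_le_linf_opnorm[OF X a(1)])
    finally show "(\<Sum>j\<in>C. \<bar>row A i \<bullet> (Q *\<^sub>v u j)\<bar>)
        \<le> linf_opnorm (pseudo_inverse (Q\<^sup>T * ?R\<^sup>T) * (Q\<^sup>T * ?RC\<^sup>T))"
      unfolding BT pseudo_inverse_transpose[OF B H] X_def .
  qed
qed

theorem theorem10:
  fixes m d p l K :: nat
    and M \<Omega> N :: "real mat"
    and \<Lambda> :: "nat set"
    and x0 y :: "real vec"
    and t c :: real
    and L :: "nat \<Rightarrow> nat set"
    and x :: "nat \<Rightarrow> real vec"
  assumes "m < d"
    and "M \<in> carrier_mat m d"
    and "distinct (rows M)"
    and "module.lin_indpt class_ring (module_vec TYPE(real) d) (set (rows M))"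
    and "\<Omega> \<in> carrier_mat p d"
    and "N\<^sup>T \<in> carrier_mat d (d - m)"
    and "distinct (cols (N\<^sup>T))"
    and "kernel.basis d M (set (cols (N\<^sup>T)))"
    and "\<Lambda> \<subseteq> {0..<p}"
    and "card \<Lambda> = l"
    and "vec_space.rank l (row_submatrix \<Omega> \<Lambda> * N\<^sup>T) = d - m"
    and "x0 \<in> carrier_vec d"
    and "row_submatrix \<Omega> \<Lambda> *\<^sub>v x0 = 0\<^sub>v l"
    and "y = M *\<^sub>v x0"
    and "c = linf_opnorm (pseudo_inverse (N * (row_submatrix \<Omega> \<Lambda>)\<^sup>T)
                            * (N * (row_submatrix \<Omega> ({0..<p} - \<Lambda>))\<^sup>T))"
    and "c < 1"
    and "0 < t" and "t \<le> 1"
    and "t \<ge> c"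
    and "K = p - l \<or> K = p + m - d"
    and "gap_run M \<Omega> y t K L x"
  shows "\<exists>k \<le> card ({0..<p} - \<Lambda>).
           x k = x0 \<or> (t = c \<and> x0 \<in> gap_solutions M \<Omega> y (L k))"
proof -
  define n C where "n = d - m" and "C = {0..<p} - \<Lambda>"
  note M = assms(2) and \<Omega> = assms(5) and \<Lambda> = assms(9) and card_\<Lambda> = assms(10) and x0 = assms(12)
    and x0_zero = assms(13) and y = assms(14) and run = assms(21)
  have NT: "N\<^sup>T \<in> carrier_mat d n" using assms(6) by (simp add: n_def)
  have R: "row_submatrix \<Omega> \<Lambda> \<in> carrier_mat l d"
    using row_submatrix_carrier[OF \<Omega> \<Lambda>] card_\<Lambda> by simp
  have B: "row_submatrix \<Omega> \<Lambda> * N\<^sup>T \<in> carrier_mat l n" using R NT by auto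
  have rank: "vec_space.rank l (row_submatrix \<Omega> \<Lambda> * N\<^sup>T) = n" using assms(11) by (simp add: n_def)
  have fin: "finite \<Lambda>" "finite C" using \<Lambda> by (auto simp: C_def intro: finite_subset)
  have ker: "mat_kernel M = {N\<^sup>T *\<^sub>v z | z. z \<in> carrier_vec n}"
    by (rule kernel_basis_cols[OF M NT assms(7,8)])
  have inj: "v = 0\<^sub>v n" if "v \<in> carrier_vec n" "row_submatrix \<Omega> \<Lambda> * N\<^sup>T *\<^sub>v v = 0\<^sub>v (card \<Lambda>)" for v
    using vec_space.full_rank_kernel[OF B rank that(1)] that(2) card_\<Lambda> by simp
  have C: "C \<subseteq> {0..<p}" by (auto simp: C_def)
  have c_eq: "linf_opnorm (pseudo_inverse ((N\<^sup>T)\<^sup>T * (row_submatrix \<Omega> \<Lambda>)\<^sup>T)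
      * ((N\<^sup>T)\<^sup>T * (row_submatrix \<Omega> C)\<^sup>T)) = c"
    using assms(15) by (simp add: C_def)
  obtain u where u: "\<And>j. j \<in> C \<Longrightarrow> u j \<in> carrier_vec n"
    and repr: "\<And>j w. j \<in> C \<Longrightarrow> w \<in> carrier_vec n \<Longrightarrow>
           (\<Sum>i\<in>\<Lambda>. (row \<Omega> i \<bullet> (N\<^sup>T *\<^sub>v u j)) * (row \<Omega> i \<bullet> (N\<^sup>T *\<^sub>v w))) = row \<Omega> j \<bullet> (N\<^sup>T *\<^sub>v w)"
    and sum_le: "\<And>i. i \<in> \<Lambda> \<Longrightarrow> (\<Sum>j\<in>C. \<bar>row \<Omega> i \<bullet> (N\<^sup>T *\<^sub>v u j)\<bar>) \<le> c"
    using pseudo_inverse_representers[OF \<Omega> NT \<Lambda> C inj] unfolding c_eq by blast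
  define F where "F z = (\<lambda>i. row \<Omega> i \<bullet> (N\<^sup>T *\<^sub>v z))" for z
  have row: "row \<Omega> i \<in> carrier_vec d" for i using \<Omega> by auto
  interpret dual_representers "F ` carrier_vec n" \<Lambda> C "\<lambda>j. F (u j)" c
  proof unfold_locales
    show "finite \<Lambda>" "finite C" by (rule fin)+
    show "\<Lambda> \<inter> C = {}" by (auto simp: C_def)
    show "c < 1" by (rule assms(16))
    show "(\<lambda>i. f i + g i) \<in> F ` carrier_vec n"
      if fg: "f \<in> F ` carrier_vec n" "g \<in> F ` carrier_vec n" for f g
    proof -
      obtain z w where zw: "f = F z" "g = F w" "z \<in> carrier_vec n" "w \<in> carrier_vec n" using fg by auto
      then have "(\<lambda>i. f i + g i) = F (z + w)"
        using NT by (auto simp: F_def mult_add_distrib_mat_vec[OF NT]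
            scalar_prod_add_distrib[OF row, of "N\<^sup>T *\<^sub>v z" "N\<^sup>T *\<^sub>v w"])
      then show ?thesis using zw by auto
    qed
    show "(\<lambda>i. s * f i) \<in> F ` carrier_vec n" if f: "f \<in> F ` carrier_vec n" for f s
    proof -
      obtain z where z: "f = F z" "z \<in> carrier_vec n" using f by auto
      then have "(\<lambda>i. s * f i) = F (s \<cdot>\<^sub>v z)"
        using NT by (auto simp: F_def mult_mat_vec[OF NT] scalar_prod_smult_distrib[OF row])
      then show ?thesis using z by auto
    qed
    show "F (u j) \<in> F ` carrier_vec n" if "j \<in> C" for j using u that by auto
    show "(\<Sum>i\<in>\<Lambda>. F (u j) i * f i) = f j" if "j \<in> C" "f \<in> F ` carrier_vec n" for f j
      using repr that by (auto simp: F_def)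
    show "(\<Sum>j\<in>C. \<bar>F (u j) i\<bar>) \<le> c" if "i \<in> \<Lambda>" for i
      using sum_le[OF that] by (simp add: F_def)
  qed
  have L0: "L 0 = \<Lambda> \<union> C" using run \<Omega> \<Lambda> by (auto simp: gap_run_def C_def)
  have card_C: "card C = p - l" using \<Lambda> card_\<Lambda> by (simp add: C_def card_Diff_subset fin)
  have "n \<le> l" by (rule vec_space.full_rank_cols_le[OF B rank])
  moreover have "l \<le> p" using \<Lambda> card_\<Lambda> card_mono[of "{0..<p}" \<Lambda>] by simp
  \<comment> \<open>From \<open>d - m \<le> l \<le> p\<close> the natural number
    \<open>p + m - d\<close> is not truncated and is at least \<open>p - l\<close>, so either
    stopping rule allows \<open>card C\<close> iterations.\<close>
  ultimately have CK: "card C \<le> K" using assms(1,20) card_C by (auto simp: n_def)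
  have L_Suc: "L (Suc k) = L k - gap_select t (\<Omega> *\<^sub>v x k) (L k)" if "k < card C" for k
    using run that CK by (auto simp: gap_run_def dest: spec[of _ "Suc k"])
  have sol: "x k \<in> gap_solutions M \<Omega> y (L k)" if "k \<le> card C" for k
  proof (cases "k = 0")
    case False
    then have "1 \<le> k \<and> k \<le> K" using that CK by simp
    then show ?thesis using run unfolding gap_run_def by blast
  qed (use run in \<open>auto simp: gap_run_def\<close>)
  have sub: "L k \<subseteq> {0..<p}" if "k \<le> card C" for k
    using that
  proof (induction k)
    case 0
    then show ?case using L0 \<Lambda> by (auto simp: C_def)
  next
    case (Suc k)
    then show ?case using L_Suc[of k] by auto
  qed
  have x0_\<Lambda>: "row \<Omega> i \<bullet> x0 = 0" if i: "i \<in> \<Lambda>" for i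
  proof -
    obtain a where "a < card \<Lambda>" "pick \<Lambda> a = i"
      by (rule pick_surj[OF fin(1) i])
    moreover from this have "(row_submatrix \<Omega> \<Lambda> *\<^sub>v x0) $ a = row \<Omega> i \<bullet> x0"
      using R card_\<Lambda> by (simp add: row_row_submatrix[OF \<Omega> \<Lambda>])
    ultimately show ?thesis using x0_zero card_\<Lambda> by simp
  qed
  \<comment> \<open>Both vectors satisfy the constraint, so their difference lies in the kernel of
    \<open>M\<close>, the range of \<open>N\<^sup>T\<close>.\<close>
  have diff: "\<exists>z\<in>carrier_vec n. x k = x0 + N\<^sup>T *\<^sub>v z" if "k \<le> card C" for k
  proof -
    have xk: "x k \<in> carrier_vec d" "M *\<^sub>v x k = M *\<^sub>v x0"
      using sol[OF that] M y by (auto simp: gap_solutions_def is_arg_min_def)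
    have "M *\<^sub>v (x k - x0) = 0\<^sub>v m"
      using xk x0 M by (simp add: mult_minus_distrib_mat_vec[OF M])
    then have "x k - x0 \<in> mat_kernel M" using xk x0 by (intro mat_kernelI[OF M]) auto
    then obtain z where z: "z \<in> carrier_vec n" "x k - x0 = N\<^sup>T *\<^sub>v z" unfolding ker by auto
    have "x k = x0 + (x k - x0)" using xk x0 by (intro eq_vecI) auto
    with z show ?thesis by auto
  qed
  have coeff: "(\<Omega> *\<^sub>v x k) $ i = row \<Omega> i \<bullet> x k" if "i < p" for i k
    using \<Omega> that by auto
  have coeff_\<Lambda>: "(\<Omega> *\<^sub>v (x0 + N\<^sup>T *\<^sub>v z)) $ i = F z i" if "i \<in> \<Lambda>" "z \<in> carrier_vec n" for i z
  proof -
    have "i < p" using that \<Lambda> by auto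
    then show ?thesis
      using \<Omega> NT that x0 x0_\<Lambda>[OF that(1)] scalar_prod_add_distrib[OF row, of x0 "N\<^sup>T *\<^sub>v z" i]
      by (auto simp: F_def)
  qed
  have stat: "stationary (L k) (($) (\<Omega> *\<^sub>v x k))" if k: "k \<le> card C" for k
    unfolding stationary_def
  proof (intro conjI)
    show "\<exists>e\<in>F ` carrier_vec n. \<forall>i\<in>\<Lambda>. (\<Omega> *\<^sub>v x k) $ i = e i"
      using diff[OF k] coeff_\<Lambda> by auto
    show "\<forall>f\<in>F ` carrier_vec n. (\<Sum>i\<in>L k. (\<Omega> *\<^sub>v x k) $ i * f i) = 0"
    proof (intro ballI, elim imageE)
      fix f z assume f: "f = F z" and z: "z \<in> carrier_vec n"
      have "(\<Sum>i\<in>L k. (\<Omega> *\<^sub>v x k) $ i * f i) = (\<Sum>i\<in>L k. (row \<Omega> i \<bullet> x k) * (row \<Omega> i \<bullet> (N\<^sup>T *\<^sub>v z)))"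
        using sub[OF k] coeff by (intro sum.cong) (auto simp: f F_def)
      also have "\<dots> = 0"
        using z by (intro gap_solution_stationary[OF M \<Omega> sub[OF k] sol[OF k]]) (auto simp: ker)
      finally show "(\<Sum>i\<in>L k. (\<Omega> *\<^sub>v x k) $ i * f i) = 0" .
    qed
  qed
  note run_facts = assms(19,18) L0 L_Suc stat
  show ?thesis
  proof (cases "t = c")
    case True
    have LC: "L (card C) \<subseteq> \<Lambda>" by (rule run_reaches_cosupport[OF run_facts])
    have LCp: "L (card C) \<subseteq> {0..<p}" using LC \<Lambda> by blast
    let ?R = "row_submatrix \<Omega> (L (card C))"
    \<comment> \<open>All remaining rows belong to \<Lambda>, so the target signal attains the least
      possible objective value 0.\<close>
    have "(?R *\<^sub>v x0) \<bullet> (?R *\<^sub>v x0) = 0"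
      using x0_\<Lambda> LC by (subst scalar_prod_row_submatrix[OF \<Omega> LCp]) (auto intro!: sum.neutral)
    moreover have "0 \<le> (?R *\<^sub>v z) \<bullet> (?R *\<^sub>v z)" for z
      by (subst scalar_prod_row_submatrix[OF \<Omega> LCp]) (auto intro!: sum_nonneg)
    ultimately have "x0 \<in> gap_solutions M \<Omega> y (L (card C))"
      using x0 y M by (auto simp: gap_solutions_def is_arg_min_linorder)
    with True show ?thesis by (auto simp: C_def)
  next
    case False
    then have "c < t" using assms(19) by simp
    then obtain k where k: "k \<le> card C" and zero: "\<And>i. i \<in> \<Lambda> \<Longrightarrow> (\<Omega> *\<^sub>v x k) $ i = 0"
      using run_annihilates_cosupport[OF run_facts] by blast
    obtain z where z: "z \<in> carrier_vec n" "x k = x0 + N\<^sup>T *\<^sub>v z" using diff[OF k] by auto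
    \<comment> \<open>Since \<open>x0\<close> contributes nothing on \<Lambda>, the vanishing
      coefficients are those of \<open>N\<^sup>T *\<^sub>v z\<close>; full rank then gives
      \<open>z = 0\<^sub>v n\<close>.\<close>
    have "row_submatrix \<Omega> \<Lambda> * N\<^sup>T *\<^sub>v z = 0\<^sub>v (card \<Lambda>)"
    proof (rule eq_vecI)
      fix a assume a: "a < dim_vec (0\<^sub>v (card \<Lambda>))"
      then have "pick \<Lambda> a \<in> \<Lambda>" using pick_in_set_le by simp
      have "(row_submatrix \<Omega> \<Lambda> * N\<^sup>T *\<^sub>v z) $ a = F z (pick \<Lambda> a)"
        using a R card_\<Lambda> by (simp add: assoc_mult_mat_vec[OF R NT z(1)] row_row_submatrix[OF \<Omega> \<Lambda>] F_def)
      also have "\<dots> = 0" using zero[OF \<open>pick \<Lambda> a \<in> \<Lambda>\<close>] coeff_\<Lambda>[OF \<open>pick \<Lambda> a \<in> \<Lambda>\<close> z(1)] z(2) by simp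
      finally show "(row_submatrix \<Omega> \<Lambda> * N\<^sup>T *\<^sub>v z) $ a = 0\<^sub>v (card \<Lambda>) $ a" using a by simp
    qed (use R card_\<Lambda> in auto)
    then have "z = 0\<^sub>v n" using inj z by blast
    moreover have "N\<^sup>T *\<^sub>v 0\<^sub>v n = 0\<^sub>v d" using NT by (intro eq_vecI) auto
    ultimately have "x k = x0" using z x0 by simp
    with k show ?thesis by (auto simp: C_def)
  qed
qed

end
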